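(* For all integers $n \ge 2$ and $d \ge 1$, $\{1,2,3\} \notin \mathcal{T}(4,n,d)$; that is, there is no $F \in \mathcal{F}(4,n,d)$ with $T(F) = \{1,2,3\}$.
   Context: For integers $n \ge 2$, $d\ge 1$, $\mathcal{F}(4,n,d)$ denotes the set of families $F = \{f_1,f_2,f_3,f_4\}$ where each $f_j$ is a homogeneous polynomial over $\mathbb{C}$ in $n$ variables of degree $d$, and no two of the $f_j$ are proportional (two polynomials are proportional if one is a complex scalar multiple of the other; in particular all $f_j$ are nonzero). The ticket of $F$ is $T(F) = \{m \in \mathbb{N} : f_1^m,\dots,f_4^m \text{ are linearly dependent over } \mathbb{C}\}$, where $\mathbb{N}$ denotes the positive integers. Finally, $\mathcal{T}(4,n,d) = \{T(F) : F \in \mathcal{F}(4,n,d)\}$. *)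

theory Defs
  imports Complex_Main "HOL-Library.Poly_Mapping"
begin

(* Multivariate complex polynomials in the indeterminates x_0, x_1, x_2, ...: finitely supported
   maps from exponent vectors to coefficients.  Multiplication on poly_mapping is convolution,
   so this type carries the polynomial ring structure. *)
type_synonym cpoly = "(nat \<Rightarrow>\<^sub>0 nat) \<Rightarrow>\<^sub>0 complex"

definition scale :: "complex \<Rightarrow> cpoly \<Rightarrow> cpoly" where
  "scale c f = Poly_Mapping.single 0 c * f"

definition monom_degree :: "(nat \<Rightarrow>\<^sub>0 nat) \<Rightarrow> nat" where
  "monom_degree \<alpha> = (\<Sum>i\<in>Poly_Mapping.keys \<alpha>. Poly_Mapping.lookup \<alpha> i)"

(* The polynomials in n variables are those in which only x_0, ..., x_{n-1} occur. *)
definition in_vars :: "nat \<Rightarrow> cpoly \<Rightarrow> bool" where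
  "in_vars n f \<longleftrightarrow> (\<forall>\<alpha>\<in>Poly_Mapping.keys f. Poly_Mapping.keys \<alpha> \<subseteq> {..<n})"

(* As usual, the zero polynomial is homogeneous of every degree. *)
definition homogeneous :: "nat \<Rightarrow> cpoly \<Rightarrow> bool" where
  "homogeneous d f \<longleftrightarrow> (\<forall>\<alpha>\<in>Poly_Mapping.keys f. monom_degree \<alpha> = d)"

(* Zero is proportional to every polynomial. *)
definition proportional :: "cpoly \<Rightarrow> cpoly \<Rightarrow> bool" where
  "proportional f g \<longleftrightarrow> (\<exists>c. f = scale c g \<or> g = scale c f)"

(* For r >= 2, pairwise non-proportionality forces all members to be nonzero. *)
definition families :: "nat \<Rightarrow> nat \<Rightarrow> nat \<Rightarrow> cpoly set set" where
  "families r n d = {F. finite F \<and> card F = r \<and>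
     (\<forall>f\<in>F. in_vars n f \<and> homogeneous d f) \<and>
     (\<forall>f\<in>F. \<forall>g\<in>F. f \<noteq> g \<longrightarrow> \<not> proportional f g)}"

(* Linear dependence of a finite indexed family, so that repeated members count as dependent. *)
definition lin_dependent :: "'i set \<Rightarrow> ('i \<Rightarrow> cpoly) \<Rightarrow> bool" where
  "lin_dependent I v \<longleftrightarrow> (\<exists>c. (\<exists>i\<in>I. c i \<noteq> 0) \<and> (\<Sum>i\<in>I. scale (c i) (v i)) = 0)"

definition ticket :: "cpoly set \<Rightarrow> nat set" where
  "ticket F = {m. 0 < m \<and> lin_dependent F (\<lambda>f. f ^ m)}"

definition tickets :: "nat \<Rightarrow> nat \<Rightarrow> nat \<Rightarrow> nat set set" where
  "tickets r n d = ticket ` families r n d"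

end

theory Submission
  imports Defs "HOL-Computational_Algebra.Fraction_Field"
    "HOL-Computational_Algebra.Fundamental_Theorem_Algebra"
    "HOL-Computational_Algebra.Polynomial_Factorial"
    "HOL-Computational_Algebra.Field_as_Ring"
begin

text \<open>
  Four pairwise non-proportional polynomials never have linearly dependent first, second and third
  powers all at once, so no ticket contains 1, 2 and 3. The argument takes place in an
  arbitrary field that contains the complex numbers, here the field of rational functions. What
  makes this possible is that two non-proportional elements x, y satisfy no non-trivial homogeneous
  relation over the complex numbers: a binary form splits into linear factors, so a relation would
  make one of these factors vanish (\<open>ev_eq_0_imp_eq_0\<close>). Hence binary forms in x and y, written as
  polynomials in t = x / y, can be compared coefficient by coefficient.

  If all four elements x, y, z, w lie in the plane spanned by x and y, their cubes are independent
  (\<open>planar_cubes_independent\<close>). Otherwise the linear relation eliminates one element,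
  and completing the square turns the quadratic relation into \<open>r\<^sup>2 = D(x, y)\<close> for some r outside the plane
  and some quadratic form D. The cubic relation becomes \<open>u(x, y) r + v(x, y) = 0\<close> after \<open>r\<^sup>2\<close> has been
  replaced by D. Then \<open>v\<^sup>2 = u\<^sup>2 D\<close>, and if u were non-zero, D would be the square of a linear form
  and r would lie in the plane after all. So u = v = 0 and D is not a square
  (\<open>conic_and_linear_relation\<close>): geometrically, the cubic curve contains an irreducible conic. Comparing
  coefficients rules this out. When the linear relation involves three of the elements, the
  cubic relation collapses completely (\<open>no_three_term_linear_relation\<close>). When it involves all four,
  the only candidate left, up to scaling, is x + y + z + w = 0 with
  \<open>x\<^sup>2 + y\<^sup>2 = z\<^sup>2 + w\<^sup>2\<close>; but then xy = zw, the conic splits into two lines, and D is a square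
  (\<open>no_four_term_linear_relation_normalized\<close>).
\<close>

section \<open>Field extensions of the complex numbers\<close>

locale complex_extension =
  fixes h :: "complex \<Rightarrow> 'k::field"
  assumes h_add: "h (a + b) = h a + h b"
    and h_mult: "h (a * b) = h a * h b"
    and h_1: "h 1 = 1"
begin

lemma h_0: "h 0 = 0"
proof -
  have "h 0 + h 0 = h 0 + 0" using h_add[of 0 0] by simp
  then show ?thesis by (rule add_left_imp_eq)
qed

lemma h_minus: "h (- a) = - h a"
  using h_add[of a "- a"] by (simp add: h_0 eq_neg_iff_add_eq_0 add.commute)

lemma h_diff: "h (a - b) = h a - h b"
  using h_add[of a "- b"] by (simp add: h_minus)

lemma h_eq_0_iff: "h a = 0 \<longleftrightarrow> a = 0"
  using h_mult[of a "inverse a"] by (cases "a = 0") (auto simp: h_0 h_1)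

lemma h_power: "h (a ^ n) = h a ^ n"
  by (induction n) (auto simp: h_1 h_mult)

lemma h_divide: "h (a / b) = h a / h b"
proof (cases "b = 0")
  case False
  then show ?thesis using h_mult[of "a / b" b] by (simp add: h_eq_0_iff field_simps)
qed (simp add: h_0)

lemma h_numeral: "h (numeral n) = numeral n"
proof -
  have "h (of_nat m) = of_nat m" for m
    by (induction m) (auto simp: h_0 h_1 h_add)
  from this[of "numeral n"] show ?thesis by simp
qed

lemmas h_hom = h_0 h_1 h_add h_mult h_minus h_diff h_divide h_numeral h_power

definition ev :: "'k \<Rightarrow> complex poly \<Rightarrow> 'k" where
  "ev t p = poly (map_poly h p) t"

lemma ev_0: "ev t 0 = 0" and ev_1: "ev t 1 = 1"
  by (simp_all add: ev_def h_1)

lemma ev_pCons: "ev t (pCons a p) = h a + t * ev t p"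
  by (simp add: ev_def map_poly_pCons h_0)

lemma ev_add: "ev t (p + q) = ev t p + ev t q"
  by (induction p q rule: poly_induct2) (simp_all add: ev_pCons ev_0 h_add algebra_simps)

lemma ev_smult: "ev t (smult a p) = h a * ev t p"
  by (induction p) (simp_all add: ev_pCons ev_0 h_mult algebra_simps)

lemma ev_mult: "ev t (p * q) = ev t p * ev t q"
  by (induction p) (simp_all add: ev_pCons ev_0 h_0 ev_add ev_smult algebra_simps)

lemma ev_minus: "ev t (- p) = - ev t p"
  using ev_add[of t p "- p"] by (simp add: ev_0 eq_neg_iff_add_eq_0 add.commute)

lemma ev_diff: "ev t (p - q) = ev t p - ev t q"
  using ev_add[of t p "- q"] by (simp add: ev_minus)

lemma ev_power: "ev t (p ^ n) = ev t p ^ n"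
  by (induction n) (auto simp: ev_1 ev_mult)

lemmas ev_hom = ev_0 ev_1 ev_pCons ev_add ev_smult ev_mult ev_minus ev_diff ev_power

text \<open>
  The complex numbers are algebraically closed, so every element outside them is transcendental:
  a polynomial of positive degree loses a linear factor \<open>t - r\<close>, whose value is non-zero.
\<close>
lemma ev_eq_0_imp_eq_0:
  assumes "t \<notin> range h" and "ev t p = 0"
  shows "p = 0"
  using assms(2)
proof (induction "degree p" arbitrary: p)
  case 0
  then obtain a where "p = [:a:]" by (metis degree_eq_zeroE)
  with 0 show ?case by (simp add: ev_hom h_eq_0_iff)
next
  case (Suc n)
  then obtain r where "poly p r = 0"
    using alg_closed_imp_poly_has_root[of p] by auto
  then obtain q where q: "p = [:- r, 1:] * q"
    by (metis dvdE poly_eq_0_iff_dvd)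
  have "q \<noteq> 0" using Suc.hyps(2) q by auto
  then have "degree p = Suc (degree q)" using degree_mult_eq[of "[:- r, 1:]" q] q by simp
  moreover have "ev t p = (t - h r) * ev t q"
    unfolding q ev_mult by (simp add: ev_hom h_hom)
  moreover have "t - h r \<noteq> 0" using assms(1) by auto
  ultimately have "q = 0" using Suc by auto
  then show ?case using q by simp
qed

section \<open>Non-proportional elements\<close>

definition parallel :: "'k \<Rightarrow> 'k \<Rightarrow> bool" where
  "parallel x y \<longleftrightarrow> (\<exists>c. x = h c * y)"

definition in_span :: "'k \<Rightarrow> 'k \<Rightarrow> 'k \<Rightarrow> bool" where
  "in_span x y z \<longleftrightarrow> (\<exists>\<alpha> \<beta>. z = h \<alpha> * y + h \<beta> * x)"

definition four_nonparallel :: "'k \<Rightarrow> 'k \<Rightarrow> 'k \<Rightarrow> 'k \<Rightarrow> bool" where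
  "four_nonparallel x y z w \<longleftrightarrow>
     distinct [x, y, z, w] \<and> pairwise (\<lambda>u v. \<not> parallel u v) {x, y, z, w}"

lemma four_nonparallelD:
  assumes "four_nonparallel x y z w"
  shows "x / y \<notin> range h" "y \<noteq> 0" "w \<noteq> 0" "\<not> parallel z x" "\<not> parallel z y"
    "\<not> parallel w x" "\<not> parallel w y" "\<not> parallel z w" "\<not> parallel w z"
proof -
  have par: "\<not> parallel u v" if "u \<in> {x, y, z, w}" "v \<in> {x, y, z, w}" "u \<noteq> v" for u v
    using assms that unfolding four_nonparallel_def pairwise_def by blast
  have ne: "x \<noteq> y" "x \<noteq> z" "x \<noteq> w" "y \<noteq> z" "y \<noteq> w" "z \<noteq> w"
    using assms by (auto simp: four_nonparallel_def)
  show "\<not> parallel z x" "\<not> parallel z y" "\<not> parallel w x" "\<not> parallel w y"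
    "\<not> parallel z w" "\<not> parallel w z"
    by (rule par; use ne in auto)+
  have zero: "parallel 0 u" for u
    unfolding parallel_def by (rule exI[of _ 0]) (simp add: h_0)
  show y: "y \<noteq> 0" and "w \<noteq> 0"
    using zero par[of y x] par[of w x] ne by auto
  have "\<not> parallel x y" by (rule par; use ne in auto)
  then show "x / y \<notin> range h" using y by (auto simp: parallel_def field_simps)
qed

text \<open>
  In the cubic relation among x, y, \<open>\<alpha>y + \<beta>x\<close> and \<open>\<gamma>y + \<delta>x\<close> the two mixed coefficients
  involve only \<open>b3\<close> and \<open>b4\<close>, and the determinant of this 2 by 2 system is
  \<open>\<alpha>\<beta>\<gamma>\<delta>(\<alpha>\<delta> - \<beta>\<gamma>)\<close> up to a non-zero constant, which is non-zero because the four elements are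
  pairwise non-parallel.
\<close>
lemma planar_cubes_independent:
  assumes four: "four_nonparallel x y z w"
    and z: "in_span x y z" and w: "in_span x y w"
    and cub: "h b1 * x ^ 3 + h b2 * y ^ 3 + h b3 * z ^ 3 + h b4 * w ^ 3 = 0"
  shows "b1 = 0 \<and> b2 = 0 \<and> b3 = 0 \<and> b4 = 0"
proof -
  note nonpar = four_nonparallelD[OF four]
  define t where "t = x / y"
  have x: "x = t * y" using nonpar by (simp add: t_def)
  obtain \<alpha> \<beta> where z: "z = h \<alpha> * y + h \<beta> * x" using z by (auto simp: in_span_def)
  obtain \<gamma> \<delta> where w: "w = h \<gamma> * y + h \<delta> * x" using w by (auto simp: in_span_def)
  have coeffs: "\<alpha> \<noteq> 0" "\<beta> \<noteq> 0" "\<gamma> \<noteq> 0" "\<delta> \<noteq> 0"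
    using nonpar z w by (auto simp: parallel_def h_0)
  have det: "\<alpha> * \<delta> \<noteq> \<beta> * \<gamma>"
  proof
    assume "\<alpha> * \<delta> = \<beta> * \<gamma>"
    then have "\<beta> = \<alpha> / \<gamma> * \<delta>" "\<alpha> = \<alpha> / \<gamma> * \<gamma>" using coeffs by (auto simp: field_simps)
    then have "h \<beta> = h (\<alpha> / \<gamma>) * h \<delta>" "h \<alpha> = h (\<alpha> / \<gamma>) * h \<gamma>" by (metis h_mult)+
    then have "z = h (\<alpha> / \<gamma>) * w" unfolding z w by (simp add: algebra_simps)
    with nonpar show False by (auto simp: parallel_def)
  qed
  let ?P = "[:b2 + b3 * \<alpha> ^ 3 + b4 * \<gamma> ^ 3,
              3 * (b3 * \<alpha>\<^sup>2 * \<beta> + b4 * \<gamma>\<^sup>2 * \<delta>),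
              3 * (b3 * \<alpha> * \<beta>\<^sup>2 + b4 * \<gamma> * \<delta>\<^sup>2),
              b1 + b3 * \<beta> ^ 3 + b4 * \<delta> ^ 3:]"
  have "ev t ?P * y ^ 3 = h b1 * x ^ 3 + h b2 * y ^ 3 + h b3 * z ^ 3 + h b4 * w ^ 3"
    unfolding z w x by (simp add: ev_hom h_hom) algebra
  then have "ev t ?P = 0" using cub nonpar by simp
  then have "?P = 0" using nonpar by (intro ev_eq_0_imp_eq_0[of t]) (auto simp: t_def)
  then have e: "b2 + b3 * \<alpha> ^ 3 + b4 * \<gamma> ^ 3 = 0"
      "3 * (b3 * \<alpha>\<^sup>2 * \<beta> + b4 * \<gamma>\<^sup>2 * \<delta>) = 0"
      "3 * (b3 * \<alpha> * \<beta>\<^sup>2 + b4 * \<gamma> * \<delta>\<^sup>2) = 0"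
      "b1 + b3 * \<beta> ^ 3 + b4 * \<delta> ^ 3 = 0"
    by simp_all
  have "3 * (b4 * \<gamma> * \<delta> * (\<beta> * \<gamma> - \<alpha> * \<delta>)) = 0" using e(2,3) by algebra
  then have "b4 = 0" using coeffs det by auto
  with e coeffs show ?thesis by auto
qed

section \<open>An element of degree two over the plane\<close>

text \<open>
  The square root of the quadratic form D is assumed to lie outside the plane of x and y. The binary
  forms are dehomogenized; comparing squares in the relation gives \<open>v\<^sup>2 = u\<^sup>2 D\<close> in the polynomial
  ring, where unique factorization makes D a square unless u vanishes. The bound on the degree
  of D is what puts a square root of D into the plane.
\<close>
lemma conic_and_linear_relation:
  assumes t: "x / y \<notin> range h" and y: "y \<noteq> 0"
    and sq: "z\<^sup>2 = ev (x / y) D * y\<^sup>2" and deg: "degree D \<le> 2"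
    and lin: "ev (x / y) u * z + ev (x / y) v * y = 0"
    and nspan: "\<not> in_span x y z"
  shows "u = 0" "v = 0" "D \<noteq> k\<^sup>2"
proof -
  define t where "t = x / y"
  have x: "x = t * y" using y by (simp add: t_def)
  have nsq: "D \<noteq> k\<^sup>2" for k
  proof
    assume k: "D = k\<^sup>2"
    then have "degree k \<le> 1" using deg by (cases "k = 0") (auto simp: power2_eq_square degree_mult_eq)
    obtain a q where q: "k = pCons a q" by (cases k)
    with \<open>degree k \<le> 1\<close> have "degree q = 0" by (auto split: if_splits)
    with q obtain b where ab: "k = [:a, b:]" by (auto elim: degree_eq_zeroE)
    have "z\<^sup>2 = (h a * y + h b * x)\<^sup>2"
      unfolding sq k ab by (simp add: ev_hom h_hom x flip: t_def) algebra
    then have "z = h a * y + h b * x \<or> z = h (- a) * y + h (- b) * x"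
      by (auto simp: power2_eq_iff h_hom)
    with nspan show False by (auto simp: in_span_def)
  qed
  have "ev t (v\<^sup>2 - u\<^sup>2 * D) * y\<^sup>2 = 0"
    using sq lin unfolding t_def[symmetric] ev_hom by algebra
  then have "v\<^sup>2 - u\<^sup>2 * D = 0"
    using t y by (intro ev_eq_0_imp_eq_0[of t]) (auto simp: t_def)
  then have vu: "v\<^sup>2 = u\<^sup>2 * D" by simp
  show u: "u = 0"
  proof (rule ccontr)
    assume "u \<noteq> 0"
    have "u\<^sup>2 dvd v\<^sup>2" using vu by simp
    then obtain k where "v = u * k" by (auto elim: dvdE)
    with vu \<open>u \<noteq> 0\<close> have "D = k\<^sup>2" by (simp add: power_mult_distrib)
    with nsq show False by blast
  qed
  show "v = 0" using vu u by simp
  show "D \<noteq> k\<^sup>2" by (rule nsq)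
qed

section \<open>The two shapes of the linear relation\<close>

text \<open>
  The squares of x, y and - x - y are independent, so the quadratic relation must involve w and says
  that \<open>w\<^sup>2\<close> is a quadratic form D in x and y. If \<open>b4\<close> is non-zero, the cubic relation then makes w a
  quotient of two binary forms, against the lemma on the conic; if it is zero, the cubes of x, y
  and - x - y are dependent.
\<close>
lemma no_three_term_linear_relation:
  assumes four: "four_nonparallel x y z w"
    and lin: "x + y + z = 0"
    and quad: "h a1 * x\<^sup>2 + h a2 * y\<^sup>2 + h a3 * z\<^sup>2 + h a4 * w\<^sup>2 = 0"
    and cub: "h b1 * x ^ 3 + h b2 * y ^ 3 + h b3 * z ^ 3 + h b4 * w ^ 3 = 0"
    and a: "\<not> (a1 = 0 \<and> a2 = 0 \<and> a3 = 0 \<and> a4 = 0)"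
    and b: "\<not> (b1 = 0 \<and> b2 = 0 \<and> b3 = 0 \<and> b4 = 0)"
  shows False
proof -
  note nonpar = four_nonparallelD[OF four]
  define t where "t = x / y"
  have x: "x = t * y" using nonpar by (simp add: t_def)
  have z: "z = - x - y" using lin by algebra
  have "in_span x y z"
    unfolding in_span_def z by (intro exI[of _ "-1"]) (simp add: h_hom)
  then have nspan: "\<not> in_span x y w"
    using planar_cubes_independent[OF four _ _ cub] b by blast
  let ?Q = "[:a2 + a3, 2 * a3, a1 + a3:]"
  have Q: "ev t ?Q * y\<^sup>2 = - h a4 * w\<^sup>2"
  proof -
    have "ev t ?Q * y\<^sup>2 = h a1 * x\<^sup>2 + h a2 * y\<^sup>2 + h a3 * z\<^sup>2"
      unfolding z x by (simp add: ev_hom h_hom) algebra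
    with quad show ?thesis by algebra
  qed
  have a4: "a4 \<noteq> 0"
  proof
    assume "a4 = 0"
    then have "ev t ?Q = 0" using Q nonpar by (simp add: h_0)
    then have "?Q = 0" using nonpar by (intro ev_eq_0_imp_eq_0[of t]) (auto simp: t_def)
    with a \<open>a4 = 0\<close> show False by auto
  qed
  define D where "D = smult (- 1 / a4) ?Q"
  have D: "w\<^sup>2 = ev (x / y) D * y\<^sup>2"
  proof -
    have "h a4 \<noteq> 0" using a4 by (simp add: h_eq_0_iff)
    have "ev t D * y\<^sup>2 = - (1 / h a4) * (ev t ?Q * y\<^sup>2)"
      unfolding D_def ev_smult by (simp add: h_hom)
    also have "\<dots> = w\<^sup>2" unfolding Q using \<open>h a4 \<noteq> 0\<close> by simp
    finally show ?thesis by (simp add: t_def)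
  qed
  let ?v = "[:b2 - b3, - 3 * b3, - 3 * b3, b1 - b3:]"
  have "(ev t (smult b4 D) * w + ev t ?v * y) * y\<^sup>2 =
      h b1 * x ^ 3 + h b2 * y ^ 3 + h b3 * z ^ 3 + h b4 * w ^ 3"
  proof -
    have "ev t ?v * y * y\<^sup>2 = h b1 * x ^ 3 + h b2 * y ^ 3 + h b3 * z ^ 3"
      unfolding z x by (simp add: ev_hom h_hom) algebra
    then show ?thesis using D unfolding ev_smult t_def[symmetric] by algebra
  qed
  then have rel: "ev (x / y) (smult b4 D) * w + ev (x / y) ?v * y = 0"
    using cub nonpar by (simp add: t_def)
  have "degree D \<le> 2" by (simp add: D_def)
  note conic = conic_and_linear_relation[OF nonpar(1,2) D this rel nspan]
  have "b1 = 0 \<and> b2 = 0 \<and> b3 = 0" using conic(2) by simp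
  moreover have "b4 = 0" using conic(1) conic(3)[of 0] by auto
  ultimately show False using b by blast
qed

text \<open>
  With s = x + y, the substitution \<open>z = r - a4 s\<close>, \<open>w = - r - a3 s\<close> solves the linear
  relation, and since \<open>a3 + a4 = 1\<close> it removes the term of the quadratic relation that is linear in r.
  The cubic relation becomes \<open>u r + v = 0\<close>, so u and v vanish identically.
  Vanishing of u forces \<open>b3 = b4\<close> (else D is a constant times \<open>s\<^sup>2\<close>, hence a square).
  This common value is non-zero, as otherwise v would have the coefficients \<open>b1\<close> and \<open>b2\<close>, so u = 0 also
  gives \<open>a3 = a4\<close>; vanishing of v then forces \<open>a1 = a2 = - 1/2\<close>. This gives \<open>D = ((x - y) / 2)\<^sup>2\<close>, a square.
\<close>
lemma no_four_term_linear_relation_normalized: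
  assumes four: "four_nonparallel x y z w"
    and lin: "x + y + z + w = 0"
    and quad: "h a1 * x\<^sup>2 + h a2 * y\<^sup>2 + h a3 * z\<^sup>2 + h a4 * w\<^sup>2 = 0"
    and cub: "h b1 * x ^ 3 + h b2 * y ^ 3 + h b3 * z ^ 3 + h b4 * w ^ 3 = 0"
    and a: "a3 + a4 = 1"
    and b: "\<not> (b1 = 0 \<and> b2 = 0 \<and> b3 = 0 \<and> b4 = 0)"
  shows False
proof -
  note nonpar = four_nonparallelD[OF four]
  define t where "t = x / y"
  have x: "x = t * y" using nonpar by (simp add: t_def)
  define r where "r = z + h a4 * (x + y)"
  have z: "z = r - h a4 * (x + y)" by (simp add: r_def)
  have ha: "h a3 = 1 - h a4" using a h_add[of a3 a4] by (simp add: h_1 algebra_simps)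
  have w: "w = - r - h a3 * (x + y)" using lin unfolding r_def ha by algebra
  have nspan: "\<not> in_span x y r"
  proof
    assume "in_span x y r"
    then obtain \<alpha> \<beta> where r: "r = h \<alpha> * y + h \<beta> * x" by (auto simp: in_span_def)
    have "z = h (\<alpha> - a4) * y + h (\<beta> - a4) * x"
      unfolding z r by (simp add: h_hom algebra_simps)
    moreover have "w = h (- \<alpha> - a3) * y + h (- \<beta> - a3) * x"
      unfolding w r by (simp add: h_hom algebra_simps)
    ultimately show False
      using planar_cubes_independent[OF four _ _ cub] b unfolding in_span_def by blast
  qed
  let ?m = "a3 * a4"
  define D where "D = [:- a2 - ?m, - 2 * ?m, - a1 - ?m:]"
  have D: "r\<^sup>2 = ev (x / y) D * y\<^sup>2"
  proof -
    have "ev t D * y\<^sup>2 = - h a1 * x\<^sup>2 - h a2 * y\<^sup>2 - h a3 * h a4 * (x + y)\<^sup>2"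
      unfolding D_def x by (simp add: ev_hom h_hom) algebra
    also have "\<dots> = r\<^sup>2" using quad unfolding z w ha by algebra
    finally show ?thesis by (simp add: t_def)
  qed
  \<comment> \<open>The cubic relation, with \<open>r\<^sup>2\<close> replaced by D: the odd powers of r give u, the even ones v.\<close>
  define u where "u = smult (b3 - b4) D + smult (3 * (b3 * a4\<^sup>2 - b4 * a3\<^sup>2)) [:1, 2, 1:]"
  define v where "v = [:b2, 0, 0, b1:] - smult (3 * (b3 * a4 + b4 * a3)) ([:1, 1:] * D)
      - smult (b3 * a4 ^ 3 + b4 * a3 ^ 3) [:1, 3, 3, 1:]"
  have rel: "ev (x / y) u * r + ev (x / y) v * y = 0"
  proof -
    have D': "r\<^sup>2 = ev t D * y\<^sup>2" using D by (simp add: t_def)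
    have u: "ev t u * y\<^sup>2 = (h b3 - h b4) * r\<^sup>2
        + 3 * (h b3 * (h a4)\<^sup>2 - h b4 * (h a3)\<^sup>2) * (x + y)\<^sup>2"
      unfolding u_def ev_add ev_smult D' x by (simp add: ev_pCons ev_0 h_hom) algebra
    have v: "ev t v * y * y\<^sup>2 = h b1 * x ^ 3 + h b2 * y ^ 3
        - 3 * (h b3 * h a4 + h b4 * h a3) * r\<^sup>2 * (x + y)
        - (h b3 * h a4 ^ 3 + h b4 * h a3 ^ 3) * (x + y) ^ 3"
      unfolding v_def ev_diff ev_smult ev_mult D' x by (simp add: ev_pCons ev_0 h_hom) algebra
    have "(ev t u * r + ev t v * y) * y\<^sup>2 = 0"
      using u v cub unfolding z w by algebra
    then show ?thesis using nonpar by (simp add: t_def)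
  qed
  have "degree D \<le> 2" by (simp add: D_def)
  note conic = conic_and_linear_relation[OF nonpar(1,2) D this rel nspan]
  have b34: "b3 = b4"
  proof (rule ccontr)
    assume "b3 \<noteq> b4"
    define \<kappa> where "\<kappa> = - 3 * (b3 * a4\<^sup>2 - b4 * a3\<^sup>2) / (b3 - b4)"
    have "3 * (b3 * a4\<^sup>2 - b4 * a3\<^sup>2) = - ((b3 - b4) * \<kappa>)"
      using \<open>b3 \<noteq> b4\<close> by (simp add: \<kappa>_def)
    then have "smult (b3 - b4) (D - smult \<kappa> [:1, 2, 1:]) = u"
      unfolding u_def by (simp only: smult_diff_right smult_smult smult_minus_left add_uminus_conv_diff)
    then have "D - smult \<kappa> [:1, 2, 1:] = 0"
      using conic(1) \<open>b3 \<noteq> b4\<close> by (metis right_minus_eq smult_eq_0_iff)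
    then have "D = smult \<kappa> [:1, 2, 1:]" by simp
    also have "\<dots> = (smult (csqrt \<kappa>) [:1, 1:])\<^sup>2"
      by (simp only: smult_power power2_csqrt) (simp add: power2_eq_square)
    finally show False using conic(3) by blast
  qed
  have u0: "b4 * (a4 - a3) = 0"
  proof -
    have "3 * (b4 * a4\<^sup>2 - b4 * a3\<^sup>2) = 0" using conic(1) b34 unfolding u_def by simp
    then have "b4 * (a4 - a3) * (a3 + a4) = 0" by algebra
    then show ?thesis using a by simp
  qed
  have b4: "b4 \<noteq> 0"
  proof
    assume "b4 = 0"
    with conic(2) b34 have "[:b2, 0, 0, b1:] = 0" unfolding v_def by simp
    with b b34 \<open>b4 = 0\<close> show False by simp
  qed
  with u0 have "a4 = a3" by simp
  with a have a34: "a3 = 1 / 2" "a4 = 1 / 2" by (simp_all add: field_simps)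
  have "[:b2 + b4 * (3 * a2 + 1 / 2), 3 * (b4 * (a2 + 1 / 2)), 3 * (b4 * (a1 + 1 / 2)),
      b1 + b4 * (3 * a1 + 1 / 2):] = v"
    unfolding v_def D_def b34 a34 by (simp add: power3_eq_cube algebra_simps)
  then have "3 * (b4 * (a2 + 1 / 2)) = 0" "3 * (b4 * (a1 + 1 / 2)) = 0"
    unfolding conic(2) pCons_eq_0_iff by blast+
  then have "a2 + 1 / 2 = 0" "a1 + 1 / 2 = 0" using b4 by (simp_all only: mult_eq_0_iff) simp_all
  then have "a1 = - 1 / 2" "a2 = - 1 / 2" by (simp_all add: eq_neg_iff_add_eq_0)
  then have "D = [:- 1 / 2, 1 / 2:]\<^sup>2"
    unfolding D_def a34 by (simp add: power2_eq_square)
  with conic(3) show False by blast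
qed

lemma no_four_term_linear_relation:
  assumes four: "four_nonparallel x y z w"
    and lin: "x + y + z + w = 0"
    and quad: "h a1 * x\<^sup>2 + h a2 * y\<^sup>2 + h a3 * z\<^sup>2 + h a4 * w\<^sup>2 = 0"
    and cub: "h b1 * x ^ 3 + h b2 * y ^ 3 + h b3 * z ^ 3 + h b4 * w ^ 3 = 0"
    and a: "a3 + a4 \<noteq> 0"
    and b: "\<not> (b1 = 0 \<and> b2 = 0 \<and> b3 = 0 \<and> b4 = 0)"
  shows False
proof -
  let ?s = "a3 + a4"
  have "h (a1 / ?s) * x\<^sup>2 + h (a2 / ?s) * y\<^sup>2 + h (a3 / ?s) * z\<^sup>2 + h (a4 / ?s) * w\<^sup>2 =
      (h a1 * x\<^sup>2 + h a2 * y\<^sup>2 + h a3 * z\<^sup>2 + h a4 * w\<^sup>2) / h ?s"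
    unfolding h_divide by (simp add: add_divide_distrib)
  then have "h (a1 / ?s) * x\<^sup>2 + h (a2 / ?s) * y\<^sup>2 + h (a3 / ?s) * z\<^sup>2 + h (a4 / ?s) * w\<^sup>2 = 0"
    using quad by simp
  moreover have "a3 / ?s + a4 / ?s = 1" using a by (simp flip: add_divide_distrib)
  ultimately show False
    using no_four_term_linear_relation_normalized[OF four lin _ cub _ b] by blast
qed

lemma parallel_scaled:
  assumes "parallel (h c * x) (h d * y)" and "c \<noteq> 0"
  shows "parallel x y"
proof -
  obtain k where "h c * x = h k * (h d * y)" using assms(1) by (auto simp: parallel_def)
  then have "x = h (k * d / c) * y" using assms(2) by (simp add: h_hom h_eq_0_iff field_simps)
  then show ?thesis unfolding parallel_def by blast
qed

text \<open>
  Multiplying each element by its coefficient in the linear relation reduces that relation to a sum of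
  some of the elements. Non-parallelism leaves at least three of them, which gives the two
  shapes treated above. In the four-term case some pair must satisfy \<open>A k + A l \<noteq> 0\<close>, as is needed for
  completing the square: if all pair sums vanished, so would every A.
\<close>
theorem no_dependent_powers_1_2_3:
  fixes g :: "'i \<Rightarrow> 'k"
  assumes card: "card I = 4"
    and nonpar: "\<And>i j. i \<in> I \<Longrightarrow> j \<in> I \<Longrightarrow> i \<noteq> j \<Longrightarrow> \<not> parallel (g i) (g j)"
    and lin: "(\<Sum>i\<in>I. h (c i) * g i) = 0" "\<exists>i\<in>I. c i \<noteq> 0"
    and quad: "(\<Sum>i\<in>I. h (a i) * g i ^ 2) = 0" "\<exists>i\<in>I. a i \<noteq> 0"
    and cub: "(\<Sum>i\<in>I. h (b i) * g i ^ 3) = 0" "\<exists>i\<in>I. b i \<noteq> 0"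
  shows False
proof -
  have fin: "finite I" using card by (metis card.infinite zero_neq_numeral)
  \<comment> \<open>Indices missing from the linear relation are scaled by 1, so that every scaling is invertible.\<close>
  define s where "s i = (if c i = 0 then 1 else c i)" for i
  define G where "G i = h (s i) * g i" for i
  define A where "A i = a i / (s i)\<^sup>2" for i
  define B where "B i = b i / (s i) ^ 3" for i
  have s: "s i \<noteq> 0" for i by (simp add: s_def)
  have hs: "h (s i) \<noteq> 0" for i using s by (simp add: h_eq_0_iff)
  have AB0: "A i = 0 \<longleftrightarrow> a i = 0" "B i = 0 \<longleftrightarrow> b i = 0" for i
    using s by (auto simp: A_def B_def)
  have quad': "(\<Sum>i\<in>I. h (A i) * G i ^ 2) = 0"
    using quad(1) hs by (simp add: A_def G_def h_hom power_mult_distrib)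
  have cub': "(\<Sum>i\<in>I. h (B i) * G i ^ 3) = 0"
    using cub(1) hs by (simp add: B_def G_def h_hom power_mult_distrib)
  have lin': "(\<Sum>i\<in>I. if c i = 0 then 0 else G i) = 0"
  proof -
    have "(if c i = 0 then 0 else G i) = h (c i) * g i" for i
      by (simp add: G_def s_def h_0)
    then show ?thesis using lin(1) by simp
  qed
  have nonpar': "\<not> parallel (G i) (G j)" if "i \<in> I" "j \<in> I" "i \<noteq> j" for i j
    using nonpar[OF that] parallel_scaled[of "s i" "g i" "s j" "g j"] s unfolding G_def by blast
  have "parallel v v" for v
    unfolding parallel_def by (rule exI[of _ 1]) (simp add: h_1)
  then have ne: "G i \<noteq> G j" if "i \<in> I" "j \<in> I" "i \<noteq> j" for i j
    using nonpar'[OF that] by metis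
  have four: "four_nonparallel (G i) (G j) (G k) (G l)"
    if I: "I = {i, j, k, l}" and d: "distinct [i, j, k, l]" for i j k l
  proof -
    have "pairwise (\<lambda>u v. \<not> parallel u v) (G ` I)"
      using nonpar' by (auto simp: pairwise_def)
    moreover have "distinct [G i, G j, G k, G l]" using ne d by (simp add: I)
    ultimately show ?thesis by (simp add: four_nonparallel_def I)
  qed
  have expand: "sum f I = f i + f j + f k + f l"
    if "I = {i, j, k, l}" "distinct [i, j, k, l]" for f :: "'i \<Rightarrow> 'k" and i j k l
    using that by (simp add: add.assoc)
  have labels: "\<exists>k l. I = {k, l, i, j} \<and> distinct [k, l, i, j]" if "i \<in> I" "j \<in> I" "i \<noteq> j" for i j
  proof -
    have "card (I - {i, j}) = 2" using that card fin by (simp add: card_Diff_subset)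
    then obtain k l where kl: "I - {i, j} = {k, l}" "k \<noteq> l" by (auto simp: card_2_iff)
    then have "k \<notin> {i, j}" "l \<notin> {i, j}" by blast+
    then have "distinct [k, l, i, j]" using kl(2) that(3) by simp
    moreover have "I = {k, l, i, j}" using kl(1) that by blast
    ultimately show ?thesis by blast
  qed
  have another: "\<exists>j\<in>I. j \<noteq> i" for i
  proof (rule ccontr)
    assume "\<not> (\<exists>j\<in>I. j \<noteq> i)"
    then have "card I \<le> card {i}" by (intro card_mono) auto
    with card show False by simp
  qed
  show False
  proof (cases "\<exists>i\<in>I. c i = 0")
    case True
    then obtain l where l: "l \<in> I" "c l = 0" by blast
    then obtain k where "k \<in> I" "k \<noteq> l" using another by blast
    then obtain i j where I: "I = {i, j, k, l}" and d: "distinct [i, j, k, l]"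
      using labels l by blast
    note four = four[OF I d]
    let ?x = "G i" and ?y = "G j" and ?z = "G k"
    have sum3: "(if c i = 0 then 0 else ?x) + (if c j = 0 then 0 else ?y)
        + (if c k = 0 then 0 else ?z) = 0"
      using lin' l unfolding expand[OF I d] by simp
    have np: "u \<noteq> 0" "u + v \<noteq> 0" if "\<not> parallel u v" for u v
      using that unfolding parallel_def
      by (metis h_0 mult_zero_left, metis add_eq_0_iff2 h_1 h_minus mult_1 mult_minus_left)
    have "\<not> parallel ?x ?y" "\<not> parallel ?y ?z" "\<not> parallel ?x ?z" "\<not> parallel ?z ?x"
      by (rule nonpar'; use d in \<open>auto simp: I\<close>)+
    note np = this[THEN np(1)] this[THEN np(2)]
    have "c i \<noteq> 0" "c j \<noteq> 0" "c k \<noteq> 0"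
      using sum3 np lin(2) l unfolding I by (auto split: if_splits)
    then have "?x + ?y + ?z = 0" using sum3 by simp
    moreover have "\<not> (A i = 0 \<and> A j = 0 \<and> A k = 0 \<and> A l = 0)"
      using quad(2) AB0(1) unfolding I by auto
    moreover have "\<not> (B i = 0 \<and> B j = 0 \<and> B k = 0 \<and> B l = 0)"
      using cub(2) AB0(2) unfolding I by auto
    ultimately show False
      using no_three_term_linear_relation[OF four _ quad'[unfolded expand[OF I d]]
          cub'[unfolded expand[OF I d]]] by metis
  next
    case False
    have "\<exists>i\<in>I. \<exists>j\<in>I. i \<noteq> j \<and> A i + A j \<noteq> 0"
    proof (rule ccontr)
      assume *: "\<not> ?thesis"
      obtain i where i: "i \<in> I" "A i \<noteq> 0" using quad(2) AB0 by blast
      then obtain j where j: "j \<in> I" "i \<noteq> j" using another by blast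
      obtain k l where kl: "I = {k, l, i, j}" "distinct [k, l, i, j]" using labels[OF i(1) j] by blast
      then have "A i + A j = 0" "A i + A k = 0" "A j + A k = 0" using * by auto
      then have "2 * A i = 0" by algebra
      with i show False by simp
    qed
    then obtain k l where kl: "k \<in> I" "l \<in> I" "k \<noteq> l" "A k + A l \<noteq> 0" by blast
    then obtain i j where I: "I = {i, j, k, l}" and d: "distinct [i, j, k, l]"
      using labels by blast
    have "G i + G j + G k + G l = 0" using lin' False unfolding expand[OF I d] unfolding I by simp
    moreover have "\<not> (B i = 0 \<and> B j = 0 \<and> B k = 0 \<and> B l = 0)"
      using cub(2) AB0(2) unfolding I by auto
    ultimately show False
      using no_four_term_linear_relation[OF four[OF I d] _ quad'[unfolded expand[OF I d]]
          cub'[unfolded expand[OF I d]] kl(4)] by metis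
  qed
qed

end

section \<open>Rational functions\<close>

definition const_fract :: "complex \<Rightarrow> cpoly fract" where
  "const_fract c = Fract (Poly_Mapping.single 0 c) 1"

interpretation cpoly_fract: complex_extension const_fract
  by unfold_locales (simp_all add: const_fract_def single_add mult_single One_fract_def)

lemma const_fract_mult: "const_fract c * Fract f 1 = Fract (scale c f) 1"
  by (simp add: const_fract_def scale_def)

lemma lin_dependent_powers_fract:
  assumes "finite F" and "lin_dependent F (\<lambda>f. f ^ m)"
  obtains c where "\<exists>f\<in>F. c f \<noteq> 0" and "(\<Sum>f\<in>F. const_fract (c f) * Fract f 1 ^ m) = 0"
proof -
  obtain c where c: "\<exists>f\<in>F. c f \<noteq> 0" "(\<Sum>f\<in>F. scale (c f) (f ^ m)) = 0"
    using assms(2) by (auto simp: lin_dependent_def)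
  have pow: "Fract f 1 ^ m = Fract (f ^ m) 1" for f :: cpoly
    by (induction m) (simp_all add: One_fract_def)
  have "(\<Sum>f\<in>F. const_fract (c f) * Fract f 1 ^ m) = (\<Sum>f\<in>F. Fract (scale (c f) (f ^ m)) 1)"
    by (simp add: pow const_fract_mult)
  also have "\<dots> = Fract (\<Sum>f\<in>F. scale (c f) (f ^ m)) 1"
    using assms(1) by induction (simp_all add: Zero_fract_def)
  also have "\<dots> = 0" by (simp add: c(2) Zero_fract_def)
  finally show ?thesis using that c(1) by blast
qed

theorem theorem5:
  fixes n d :: nat
  assumes "n \<ge> 2" and "d \<ge> 1"
  shows "{1, 2, 3} \<notin> tickets 4 n d"
proof
  assume "{1, 2, 3} \<in> tickets 4 n d"
  then obtain F where F: "F \<in> families 4 n d" and T: "ticket F = {1, 2, 3}"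
    by (auto simp: tickets_def)
  have fin: "finite F" and card: "card F = 4"
    and np: "\<And>f g. f \<in> F \<Longrightarrow> g \<in> F \<Longrightarrow> f \<noteq> g \<Longrightarrow> \<not> proportional f g"
    using F by (auto simp: families_def)
  have dep: "lin_dependent F (\<lambda>f. f ^ m)" if "m \<in> {1, 2, 3}" for m
    using that T[symmetric] by (auto simp: ticket_def)
  obtain c where c: "\<exists>f\<in>F. c f \<noteq> 0" "(\<Sum>f\<in>F. const_fract (c f) * Fract f 1 ^ 1) = 0"
    using lin_dependent_powers_fract[OF fin dep, of 1] by auto
  obtain a where a: "\<exists>f\<in>F. a f \<noteq> 0" "(\<Sum>f\<in>F. const_fract (a f) * Fract f 1 ^ 2) = 0"
    using lin_dependent_powers_fract[OF fin dep, of 2] by auto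
  obtain b where b: "\<exists>f\<in>F. b f \<noteq> 0" "(\<Sum>f\<in>F. const_fract (b f) * Fract f 1 ^ 3) = 0"
    using lin_dependent_powers_fract[OF fin dep, of 3] by auto
  have "\<not> cpoly_fract.parallel (Fract f 1) (Fract g 1)" if "f \<in> F" "g \<in> F" "f \<noteq> g" for f g
    using np[OF that]
    by (auto simp: cpoly_fract.parallel_def const_fract_mult eq_fract proportional_def)
  then show False
    using cpoly_fract.no_dependent_powers_1_2_3[of F "\<lambda>f. Fract f 1" c a b] card a b c by simp
qed

end
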